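(* Let $X$ be a Banach space over $\mathbb K$ with a continuous family $\{\omega(s)\}_{s\in J}$ of symplectic structures, where $J$ is a connected topological space. Let $\{\lambda(s)\}_{s\in J}$ be a continuous family of closed subspaces of $X$ such that $\lambda(s)\subset\lambda(s)^{\omega(s)}$ for each $s\in J$. Assume that $\{\lambda(s)^{\omega(s)}\}_{s\in J}$ and $\{\lambda(s)^{\omega(s)\omega(s)}\}_{s\in J}$ are also continuous families of closed subspaces of $X$. Assume that there is an $s_0\in J$ such that $\lambda(s_0)$ is a maximal isotropic subspace of $(X,\omega(s_0))$ satisfying $\gamma_{\lambda(s_0)}>0$ if $h_{\lambda(s_0)}\neq0$, and that each $s\in J$ for which $\lambda(s)$ is a maximal isotropic subspace of $(X,\omega(s))$ satisfies $\gamma_{\lambda(s)}>0$ if $h_{\lambda(s)}\ne0$. Then for each $s\in J$, $\lambda(s)$ is a maximal isotropic subspace of $(X,\omega(s))$ and $h_{\lambda(s)}=h_{\lambda(s_0)}$.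
   Context: $\mathbb K$ is $\mathbb R$ or $\mathbb C$, and $\mathrm i=\sqrt{-1}$. Sesquilinear forms are linear in the first and conjugate-linear in the second variable (bilinear if $\mathbb K=\mathbb R$). A form $\omega:X\times X\to\mathbb K$ is skew symmetric if $\omega(y,x)=-\overline{\omega(x,y)}$. For a linear subspace $\lambda\subset X$, $\lambda^\omega:=\{y\in X:\omega(x,y)=0\ \forall x\in\lambda\}$ and $\lambda^{\omega\omega}:=(\lambda^\omega)^\omega$; $\omega$ is non-degenerate if $X^\omega=\{0\}$. A symplectic structure on the Banach space $X$ is a bounded non-degenerate skew symmetric sesquilinear form $\omega$. $X^*$ is the Banach space of bounded conjugate-linear forms on $X$, and $L_\omega:X\to X^*$, $(L_\omega x)(y)=\omega(x,y)$. A family $\{\omega(s)\}$ is continuous if $s\mapsto L_{\omega(s)}$ is continuous in operator norm. A family of closed subspaces is continuous if it is continuous for the gap topology, i.e. the topology on the set of closed subspaces defined by the gap $\hat\delta(M,N)=\max\{\delta(M,N),\delta(N,M)\}$, where $\delta(M,N):=\sup_{u\in M,\|u\|=1}\operatorname{dist}(u,N)$ if $M\neq\{0\}$ and $\delta(\{0\},N):=0$. A linear subspace $\lambda$ is isotropic if $\lambda\subset\lambda^\omega$, and maximal isotropic if it is isotropic and every isotropic subspace containing $\lambda$ equals $\lambda$. For isotropic $\lambda$, the form $\tilde\omega(x+\lambda,y+\lambda):=\omega(x,y)$ is well defined on $\lambda^\omega/\lambda$. If $\lambda$ is maximal isotropic, then $\lambda=\lambda^{\omega\omega}$ is closed and either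 $\lambda=\lambda^\omega$, or $\mathbb K=\mathbb C$ and $\mathrm i\tilde\omega$ is (positive or negative) definite on $\lambda^\omega/\lambda\neq\{0\}$. The sign $h_\lambda$ is $0$ if $\lambda=\lambda^\omega$, and otherwise $h_\lambda=\pm1$ when $\pm\mathrm i\tilde\omega$ is positive definite on $\lambda^\omega/\lambda$. The reduced minimum modulus is $\gamma_\lambda:=\inf_{x\in\lambda^\omega\setminus\lambda}\frac{\mathrm i h_\lambda\omega(x,x)}{\operatorname{dist}(x,\lambda)^2}$ if $\lambda\subsetneq\lambda^\omega$, and $\gamma_\lambda:=0$ if $\lambda=\lambda^\omega$. For $\lambda(s)$ these are taken with respect to $\omega(s)$. *)

theory Defs
  imports "HOL-Analysis.Analysis"
begin

text \<open>
  A scalar field that is (isometrically isomorphic to) the reals or the complex numbers. The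
  embedding \<open>to_complex\<close> gives a meaning to the imaginary unit also when the field is real;
  the lemma \<open>range_to_complex\<close> shows that the axioms leave no other possibility.
\<close>

class real_or_complex = real_normed_field +
  fixes to_complex :: "'a \<Rightarrow> complex"
    and kconj :: "'a \<Rightarrow> 'a"
  assumes to_complex_add: "to_complex (x + y) = to_complex x + to_complex y"
    and to_complex_mult: "to_complex (x * y) = to_complex x * to_complex y"
    and to_complex_one: "to_complex 1 = 1"
    and to_complex_scaleR: "to_complex (r *\<^sub>R x) = r *\<^sub>R to_complex x"
    and norm_to_complex: "norm (to_complex x) = norm x"
    and to_complex_conj: "to_complex (kconj x) = cnj (to_complex x)"

instantiation real :: real_or_complex
begin
definition to_complex_real :: "real \<Rightarrow> complex" where "to_complex_real x = complex_of_real x"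
definition kconj_real :: "real \<Rightarrow> real" where "kconj_real x = x"
instance
  by standard (simp_all add: to_complex_real_def kconj_real_def scaleR_conv_of_real)
end

instantiation complex :: real_or_complex
begin
definition to_complex_complex :: "complex \<Rightarrow> complex" where "to_complex_complex x = x"
definition kconj_complex :: "complex \<Rightarrow> complex" where "kconj_complex x = cnj x"
instance
  by standard (simp_all add: to_complex_complex_def kconj_complex_def)
end

lemma range_to_complex:
  "range (to_complex :: 'k::real_or_complex \<Rightarrow> complex) = \<real> \<or>
   range (to_complex :: 'k \<Rightarrow> complex) = UNIV"
proof (cases "range (to_complex :: 'k \<Rightarrow> complex) \<subseteq> \<real>")
  case True
  have "complex_of_real r \<in> range (to_complex :: 'k \<Rightarrow> complex)" for r
  proof -
    have "complex_of_real r = to_complex (r *\<^sub>R (1::'k))"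
      by (simp only: to_complex_scaleR to_complex_one of_real_def)
    then show ?thesis by blast
  qed
  with True show ?thesis by (auto simp: Reals_def)
next
  case False
  then obtain a :: 'k where a: "Im (to_complex a) \<noteq> 0"
    unfolding complex_is_Real_iff subset_iff by blast
  have "z \<in> range (to_complex :: 'k \<Rightarrow> complex)" for z
  proof -
    define t where "t = Im z / Im (to_complex a)"
    define r where "r = Re z - t * Re (to_complex a)"
    have "z = to_complex (t *\<^sub>R a + r *\<^sub>R 1)"
      using a by (simp add: to_complex_add to_complex_scaleR to_complex_one complex_eq_iff
          t_def r_def)
    then show ?thesis by blast
  qed
  then show ?thesis by blast
qed

text \<open>
  A Banach space over the field: a real Banach space with a scalar multiplication that extends
  the real one and for which the norm is homogeneous.
\<close>

locale banach_space_over = vector_space smul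
  for smul :: "'k::real_or_complex \<Rightarrow> 'a::banach \<Rightarrow> 'a" +
  assumes scale_of_real: "smul (of_real r) x = r *\<^sub>R x"
    and norm_scale: "norm (smul c x) = norm c * norm x"

definition sesquilinear ::
    "('k::real_or_complex \<Rightarrow> 'a::banach \<Rightarrow> 'a) \<Rightarrow> ('a \<Rightarrow> 'a \<Rightarrow> 'k) \<Rightarrow> bool" where
  "sesquilinear smul \<omega> \<longleftrightarrow>
     (\<forall>x x' y. \<omega> (x + x') y = \<omega> x y + \<omega> x' y) \<and>
     (\<forall>c x y. \<omega> (smul c x) y = c * \<omega> x y) \<and>
     (\<forall>x y y'. \<omega> x (y + y') = \<omega> x y + \<omega> x y') \<and>
     (\<forall>c x y. \<omega> x (smul c y) = kconj c * \<omega> x y)"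

definition bounded_form :: "('a::banach \<Rightarrow> 'a \<Rightarrow> 'k::real_or_complex) \<Rightarrow> bool" where
  "bounded_form \<omega> \<longleftrightarrow> (\<exists>B. \<forall>x y. norm (\<omega> x y) \<le> B * norm x * norm y)"

definition skew_symmetric :: "('a::banach \<Rightarrow> 'a \<Rightarrow> 'k::real_or_complex) \<Rightarrow> bool" where
  "skew_symmetric \<omega> \<longleftrightarrow> (\<forall>x y. \<omega> y x = - kconj (\<omega> x y))"

definition annihilator :: "('a::banach \<Rightarrow> 'a \<Rightarrow> 'k::real_or_complex) \<Rightarrow> 'a set \<Rightarrow> 'a set" where
  "annihilator \<omega> S = {y. \<forall>x\<in>S. \<omega> x y = 0}"

definition nondegenerate :: "('a::banach \<Rightarrow> 'a \<Rightarrow> 'k::real_or_complex) \<Rightarrow> bool" where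
  "nondegenerate \<omega> \<longleftrightarrow> annihilator \<omega> UNIV = {0}"

definition symplectic ::
    "('k::real_or_complex \<Rightarrow> 'a::banach \<Rightarrow> 'a) \<Rightarrow> ('a \<Rightarrow> 'a \<Rightarrow> 'k) \<Rightarrow> bool" where
  "symplectic smul \<omega> \<longleftrightarrow>
     sesquilinear smul \<omega> \<and> bounded_form \<omega> \<and> skew_symmetric \<omega> \<and> nondegenerate \<omega>"

text \<open>
  The bounded conjugate-linear forms are a subspace of the bounded real-linear maps
  \<open>'a \<Rightarrow>\<^sub>L 'k\<close>, with the same operator norm. Hence the map \<open>x \<mapsto> \<omega>(x, \<cdot>)\<close> may be taken in
  \<open>'a \<Rightarrow>\<^sub>L 'a \<Rightarrow>\<^sub>L 'k\<close>, whose topology is that of the operator norm.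
\<close>

definition form_map ::
    "('a::banach \<Rightarrow> 'a \<Rightarrow> 'k::real_or_complex) \<Rightarrow> 'a \<Rightarrow>\<^sub>L 'a \<Rightarrow>\<^sub>L 'k" where
  "form_map \<omega> = Blinfun (\<lambda>x. Blinfun (\<lambda>y. \<omega> x y))"

lemma form_map_apply:
  fixes smul :: "'k::real_or_complex \<Rightarrow> 'a::banach \<Rightarrow> 'a"
  assumes "banach_space_over smul" "sesquilinear smul \<omega>" "bounded_form \<omega>"
  shows "blinfun_apply (blinfun_apply (form_map \<omega>) x) y = \<omega> x y"
proof -
  interpret banach_space_over smul by fact
  have kconj_real: "kconj (of_real r :: 'k) = of_real r" for r
  proof -
    have emb: "to_complex (of_real r :: 'k) = complex_of_real r"
      by (simp add: of_real_def to_complex_scaleR to_complex_one)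
    have "to_complex (kconj (of_real r :: 'k) - of_real r) = 0"
      using to_complex_add[of "kconj (of_real r :: 'k) - of_real r" "of_real r"]
      by (simp add: emb to_complex_conj)
    then have "norm (kconj (of_real r :: 'k) - of_real r) = 0"
      by (metis norm_to_complex norm_zero)
    then show ?thesis by simp
  qed
  have add1: "\<omega> (u + u') v = \<omega> u v + \<omega> u' v"
    and add2: "\<omega> u (v + v') = \<omega> u v + \<omega> u v'" for u u' v v'
    using assms(2) by (auto simp: sesquilinear_def)
  have sc1: "\<omega> (r *\<^sub>R u) v = r *\<^sub>R \<omega> u v" and sc2: "\<omega> u (r *\<^sub>R v) = r *\<^sub>R \<omega> u v" for r u v
    using assms(2) by (simp_all add: sesquilinear_def flip: scale_of_real)
      (simp_all add: kconj_real scaleR_conv_of_real)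
  obtain B where B: "\<And>u v. norm (\<omega> u v) \<le> B * norm u * norm v"
    using assms(3) by (auto simp: bounded_form_def)
  interpret b: bounded_bilinear \<omega>
    by (rule bounded_bilinear.intro)
       (auto simp: add1 add2 sc1 sc2 intro!: exI[of _ B] order.trans[OF B] simp: ac_simps)
  have inner: "blinfun_apply (Blinfun (\<omega> u)) v = \<omega> u v" for u v
    by (simp add: bounded_linear_Blinfun_apply b.bounded_linear_right)
  have "bounded_linear (\<lambda>u. Blinfun (\<omega> u))"
  proof (rule bounded_linear_intro[where K = "\<bar>B\<bar>"])
    fix u u' and r :: real
    show "Blinfun (\<omega> (u + u')) = Blinfun (\<omega> u) + Blinfun (\<omega> u')"
      by (rule blinfun_eqI) (simp add: inner add1 plus_blinfun.rep_eq)
    show "Blinfun (\<omega> (r *\<^sub>R u)) = r *\<^sub>R Blinfun (\<omega> u)"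
      by (rule blinfun_eqI) (simp add: inner sc1 scaleR_blinfun.rep_eq)
    show "norm (Blinfun (\<omega> u)) \<le> norm u * \<bar>B\<bar>"
    proof (rule norm_blinfun_bound)
      fix v
      have "norm (\<omega> u v) \<le> B * (norm u * norm v)" using B by (simp add: mult.assoc)
      also have "\<dots> \<le> \<bar>B\<bar> * (norm u * norm v)" by (intro mult_right_mono) auto
      finally show "norm (blinfun_apply (Blinfun (\<omega> u)) v) \<le> norm u * \<bar>B\<bar> * norm v"
        by (simp add: inner ac_simps)
    qed simp
  qed
  then show ?thesis
    by (simp add: form_map_def bounded_linear_Blinfun_apply inner)
qed

definition closed_subspaces ::
    "('k::real_or_complex \<Rightarrow> 'a::banach \<Rightarrow> 'a) \<Rightarrow> 'a set set" where
  "closed_subspaces smul = {M. module.subspace smul M \<and> closed M}"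

definition semigap :: "'a::banach set \<Rightarrow> 'a set \<Rightarrow> real" where
  "semigap M N = (if M = {0} then 0 else (SUP u\<in>{u \<in> M. norm u = 1}. infdist u N))"

definition gap :: "'a::banach set \<Rightarrow> 'a set \<Rightarrow> real" where
  "gap M N = max (semigap M N) (semigap N M)"

text \<open>
  The gap need not satisfy the triangle inequality, so the topology is given through its
  open sets: those containing a gap ball around each of their points.
\<close>

definition gap_topology ::
    "('k::real_or_complex \<Rightarrow> 'a::banach \<Rightarrow> 'a) \<Rightarrow> 'a set topology" where
  "gap_topology smul = topology (\<lambda>U. U \<subseteq> closed_subspaces smul \<and>
     (\<forall>M\<in>U. \<exists>\<epsilon>>0. \<forall>N\<in>closed_subspaces smul. gap M N < \<epsilon> \<longrightarrow> N \<in> U))"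

lemma openin_gap_topology:
  "openin (gap_topology smul) U \<longleftrightarrow> U \<subseteq> closed_subspaces smul \<and>
     (\<forall>M\<in>U. \<exists>\<epsilon>>0. \<forall>N\<in>closed_subspaces smul. gap M N < \<epsilon> \<longrightarrow> N \<in> U)"
proof -
  let ?P = "\<lambda>U. U \<subseteq> closed_subspaces smul \<and>
     (\<forall>M\<in>U. \<exists>\<epsilon>>0. \<forall>N\<in>closed_subspaces smul. gap M N < \<epsilon> \<longrightarrow> N \<in> U)"
  have "?P (S \<inter> T)" if S: "?P S" and T: "?P T" for S T
  proof (intro conjI ballI)
    show "S \<inter> T \<subseteq> closed_subspaces smul" using S by blast
    fix M assume M: "M \<in> S \<inter> T"
    obtain d where d: "d > 0" "\<forall>N\<in>closed_subspaces smul. gap M N < d \<longrightarrow> N \<in> S"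
      using S M by blast
    obtain e where e: "e > 0" "\<forall>N\<in>closed_subspaces smul. gap M N < e \<longrightarrow> N \<in> T"
      using T M by blast
    show "\<exists>\<epsilon>>0. \<forall>N\<in>closed_subspaces smul. gap M N < \<epsilon> \<longrightarrow> N \<in> S \<inter> T"
      using d e by (intro exI[of _ "min d e"]) auto
  qed
  moreover have "?P (\<Union>K)" if K: "\<forall>S\<in>K. ?P S" for K
  proof (intro conjI ballI)
    show "\<Union>K \<subseteq> closed_subspaces smul" using K by blast
    fix M assume "M \<in> \<Union>K"
    then obtain S where "S \<in> K" "M \<in> S" by blast
    then show "\<exists>\<epsilon>>0. \<forall>N\<in>closed_subspaces smul. gap M N < \<epsilon> \<longrightarrow> N \<in> \<Union>K"
      using K by (metis UnionI)
  qed
  ultimately have "istopology ?P" unfolding istopology_def by blast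
  then show ?thesis by (simp add: gap_topology_def)
qed

lemma topspace_gap_topology [simp]:
  "topspace (gap_topology smul) = closed_subspaces smul"
proof -
  have "openin (gap_topology smul) (closed_subspaces smul)"
    unfolding openin_gap_topology by (auto intro: exI[of _ "1::real"])
  moreover have "U \<subseteq> closed_subspaces smul" if "openin (gap_topology smul) U" for U
    using that by (simp add: openin_gap_topology)
  ultimately show ?thesis by (auto simp: topspace_def)
qed

definition isotropic ::
    "('k::real_or_complex \<Rightarrow> 'a::banach \<Rightarrow> 'a) \<Rightarrow> ('a \<Rightarrow> 'a \<Rightarrow> 'k) \<Rightarrow> 'a set \<Rightarrow> bool" where
  "isotropic smul \<omega> S \<longleftrightarrow> module.subspace smul S \<and> S \<subseteq> annihilator \<omega> S"

definition maximal_isotropic ::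
    "('k::real_or_complex \<Rightarrow> 'a::banach \<Rightarrow> 'a) \<Rightarrow> ('a \<Rightarrow> 'a \<Rightarrow> 'k) \<Rightarrow> 'a set \<Rightarrow> bool" where
  "maximal_isotropic smul \<omega> S \<longleftrightarrow>
     isotropic smul \<omega> S \<and> (\<forall>M. isotropic smul \<omega> M \<and> S \<subseteq> M \<longrightarrow> M = S)"

text \<open>
  The quotient of the annihilator of \<open>S\<close> by \<open>S\<close> is rendered as the set of cosets, with zero
  element \<open>S\<close>. The form on it is the common value of \<open>\<omega>\<close> on representatives.
\<close>

definition coset :: "'a::banach set \<Rightarrow> 'a \<Rightarrow> 'a set" where
  "coset S x = (\<lambda>u. x + u) ` S"

definition reduced_space ::
    "('a::banach \<Rightarrow> 'a \<Rightarrow> 'k::real_or_complex) \<Rightarrow> 'a set \<Rightarrow> 'a set set" where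
  "reduced_space \<omega> S = coset S ` annihilator \<omega> S"

definition reduced_form ::
    "('a::banach \<Rightarrow> 'a \<Rightarrow> 'k::real_or_complex) \<Rightarrow> 'a set \<Rightarrow> 'a set \<Rightarrow> 'k" where
  "reduced_form \<omega> A B = (THE c. \<forall>x\<in>A. \<forall>y\<in>B. \<omega> x y = c)"

lemma reduced_form_coset:
  fixes smul :: "'k::real_or_complex \<Rightarrow> 'a::banach \<Rightarrow> 'a"
  assumes "banach_space_over smul" "sesquilinear smul \<omega>" "skew_symmetric \<omega>"
    and "isotropic smul \<omega> S" "x \<in> annihilator \<omega> S" "y \<in> annihilator \<omega> S"
  shows "reduced_form \<omega> (coset S x) (coset S y) = \<omega> x y"
proof -
  interpret banach_space_over smul by fact
  have z: "0 \<in> S"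
    using assms(4) by (simp add: isotropic_def subspace_0)
  have conj0: "kconj (0::'k) = 0"
    by (metis complex_cnj_zero norm_eq_zero norm_to_complex to_complex_conj)
  have "\<omega> x u = 0" if "u \<in> S" for u
  proof -
    have "\<omega> u x = 0" using assms(5) that by (simp add: annihilator_def)
    then show ?thesis using assms(3) conj0 unfolding skew_symmetric_def
      by (metis neg_equal_0_iff_equal)
  qed
  moreover have "\<omega> u y = 0" "\<omega> u v = 0" if "u \<in> S" "v \<in> S" for u v
    using assms(4,6) that by (auto simp: annihilator_def isotropic_def)
  ultimately have *: "\<omega> (x + u) (y + v) = \<omega> x y" if "u \<in> S" "v \<in> S" for u v
    using assms(2) that by (simp add: sesquilinear_def)
  show ?thesis
    unfolding reduced_form_def coset_def
    by (rule the_equality) (use * z in force)+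
qed

definition positive_definite_on :: "'b set \<Rightarrow> 'b \<Rightarrow> ('b \<Rightarrow> 'b \<Rightarrow> complex) \<Rightarrow> bool" where
  "positive_definite_on Q z q \<longleftrightarrow> (\<forall>A\<in>Q. A \<noteq> z \<longrightarrow> q A A \<in> \<real> \<and> Re (q A A) > 0)"

text \<open>
  For a maximal isotropic subspace one of the first three cases applies.
\<close>

definition form_sign :: "('a::banach \<Rightarrow> 'a \<Rightarrow> 'k::real_or_complex) \<Rightarrow> 'a set \<Rightarrow> int" where
  "form_sign \<omega> S =
     (if S = annihilator \<omega> S then 0
      else if positive_definite_on (reduced_space \<omega> S) S
                (\<lambda>A B. \<i> * to_complex (reduced_form \<omega> A B)) then 1
      else if positive_definite_on (reduced_space \<omega> S) S
                (\<lambda>A B. - \<i> * to_complex (reduced_form \<omega> A B)) then - 1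
      else undefined)"

text \<open>
  For the \<open>\<omega>\<close> considered here the number under \<open>Re\<close> is real, because \<open>\<omega>\<close> is skew symmetric.
\<close>

definition reduced_min_modulus ::
    "('a::banach \<Rightarrow> 'a \<Rightarrow> 'k::real_or_complex) \<Rightarrow> 'a set \<Rightarrow> real" where
  "reduced_min_modulus \<omega> S =
     (if S = annihilator \<omega> S then 0
      else (INF x \<in> annihilator \<omega> S - S.
              Re (\<i> * of_int (form_sign \<omega> S) * to_complex (\<omega> x x)) / (infdist x S)\<^sup>2))"

end

theory Submission
  imports Defs "HOL-Library.Quadratic_Discriminant"
begin

text \<open>
  Call \<open>Re (\<i> \<omega>(x, x))\<close> the energy of \<open>x\<close>. An isotropic subspace \<open>\<lambda>\<close> is maximal of sign \<open>h\<close> if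
  \<open>h = 0\<close> and \<open>\<lambda> = \<lambda>\<^sup>\<omega>\<close>, or \<open>h = \<plusminus>1\<close>, \<open>\<lambda> \<noteq> \<lambda>\<^sup>\<omega>\<close> and \<open>h\<close> times the energy is positive on
  \<open>\<lambda>\<^sup>\<omega> - \<lambda>\<close>. For a fixed \<open>h\<close> the parameters with this property form an open and closed set.
  It is open because \<open>\<gamma> > 0\<close> makes the energy coercive modulo \<open>\<lambda>\<close>, which survives small
  perturbations of \<open>\<omega>\<close>, \<open>\<lambda>\<close> and \<open>\<lambda>\<^sup>\<omega>\<close>. It is closed because the energy remains
  semidefinite in the limit, so that by Cauchy-Schwarz its null vectors in \<open>\<lambda>\<^sup>\<omega>\<close> lie in \<open>\<lambda>\<^sup>\<omega>\<^sup>\<omega>\<close>; and the equation \<open>\<lambda> = \<lambda>\<^sup>\<omega>\<^sup>\<omega>\<close>,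
  valid for maximal isotropic subspaces, also passes to the limit. In both directions
  \<open>\<lambda> = \<lambda>\<^sup>\<omega>\<close> is stable, since nested closed subspaces at gap less than 1 are equal.
\<close>

section \<open>The gap of subspaces\<close>

text \<open>Distances need not be attained in a Banach space, so near-minimisers replace nearest
  points throughout. Non-emptiness matters because \<open>infdist\<close> to the empty set is
  0.\<close>

lemma infdist_lessD:
  assumes "infdist x A < e" "A \<noteq> {}"
  obtains a where "a \<in> A" "dist x a < e"
  using assms cInf_lessD[of "dist x ` A" e] by (auto simp: infdist_def)

lemma infdist_le_norm:
  assumes "subspace A"
  shows "infdist x A \<le> norm x"
  using infdist_le[OF subspace_0[OF assms], of x] by simp

lemma infdist_le_infdist_diff:
  fixes x :: "'a::real_normed_vector"
  assumes "subspace A" "a \<in> A"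
  shows "infdist x A \<le> infdist (x - a) A"
proof (rule field_le_epsilon)
  fix e :: real assume "e > 0"
  then have "infdist (x - a) A < infdist (x - a) A + e" by simp
  then obtain b where b: "b \<in> A" "dist (x - a) b < infdist (x - a) A + e"
    using infdist_lessD assms(2) by blast
  have "infdist x A \<le> dist x (a + b)" using b assms by (simp add: infdist_le subspace_add)
  then show "infdist x A \<le> infdist (x - a) A + e"
    using b by (simp add: dist_norm algebra_simps)
qed

lemma infdist_scaleR_le:
  fixes x :: "'a::real_normed_vector"
  assumes "subspace A"
  shows "infdist (r *\<^sub>R x) A \<le> \<bar>r\<bar> * infdist x A"
proof (rule field_le_epsilon)
  fix e :: real assume e: "e > 0"
  \<comment> \<open>The \<open>+ 1\<close> keeps the denominator positive when
    \<open>r = 0\<close>.\<close>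
  have "infdist x A < infdist x A + e / (\<bar>r\<bar> + 1)" using e by simp
  then obtain a where a: "a \<in> A" "dist x a < infdist x A + e / (\<bar>r\<bar> + 1)"
    using infdist_lessD subspace_0[OF assms] by blast
  have "infdist (r *\<^sub>R x) A \<le> dist (r *\<^sub>R x) (r *\<^sub>R a)"
    by (rule infdist_le) (simp add: a assms subspace_scale)
  also have "\<dots> = \<bar>r\<bar> * dist x a" by (simp add: dist_norm flip: scaleR_diff_right)
  also have "\<dots> \<le> \<bar>r\<bar> * (infdist x A + e / (\<bar>r\<bar> + 1))"
    using a by (intro mult_left_mono) auto
  also have "\<dots> = \<bar>r\<bar> * infdist x A + e * (\<bar>r\<bar> / (\<bar>r\<bar> + 1))"
    by (simp add: algebra_simps)
  also have "\<dots> \<le> \<bar>r\<bar> * infdist x A + e * 1"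
    using e by (intro add_left_mono mult_left_mono) auto
  finally show "infdist (r *\<^sub>R x) A \<le> \<bar>r\<bar> * infdist x A + e" by simp
qed

text \<open>By homogeneity it suffices to treat unit vectors. Their distances to \<open>N\<close>
  are at most 1 because \<open>N\<close> contains 0, so the supremum is a genuine upper
  bound.\<close>

lemma infdist_le_semigap:
  assumes "subspace M" "subspace N" "x \<in> M"
  shows "infdist x N \<le> semigap M N * norm x"
proof (cases "x = 0")
  case True
  then show ?thesis using infdist_le_norm[OF assms(2), of x] by simp
next
  case False
  define u where "u = (1 / norm x) *\<^sub>R x"
  have u: "u \<in> M" "norm u = 1"
    using False assms by (auto simp: u_def subspace_scale)
  have "infdist u N \<le> (SUP u\<in>{u \<in> M. norm u = 1}. infdist u N)"
    using u infdist_le_norm[OF assms(2)] by (intro cSUP_upper bdd_aboveI2[where M = 1]) (auto, metis)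
  also have "\<dots> = semigap M N" using False assms by (auto simp: semigap_def)
  finally have "norm x * infdist u N \<le> norm x * semigap M N" by (simp add: mult_left_mono)
  moreover have "infdist x N \<le> norm x * infdist u N"
    using infdist_scaleR_le[OF assms(2), of "norm x" u] False by (simp add: u_def)
  ultimately show ?thesis by (simp add: mult.commute)
qed

text \<open>The strict inequality leaves room for a near-minimiser. Multiplication by
  \<open>norm x\<close> destroys it only for \<open>x = 0\<close>, where \<open>y = 0\<close>
  serves.\<close>

lemma semigap_approx:
  assumes "subspace M" "subspace N" "x \<in> M" "semigap M N < \<epsilon>"
  obtains y where "y \<in> N" "norm (x - y) \<le> \<epsilon> * norm x"
proof (cases "x = 0")
  case True
  then show ?thesis using that[of 0] subspace_0[OF assms(2)] by simp
next
  case False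
  have "infdist x N \<le> semigap M N * norm x" using assms by (intro infdist_le_semigap)
  also have "\<dots> < \<epsilon> * norm x" using False assms by simp
  finally obtain y where "y \<in> N" "dist x y < \<epsilon> * norm x"
    using infdist_lessD subspace_0[OF assms(2)] by blast
  then show ?thesis using that[of y] by (simp add: dist_norm)
qed

text \<open>\<open>d \<ge> 0\<close> covers the conventional value at \<open>{0}\<close>. Otherwise
  normalising a nonzero vector shows that the supremum is over a nonempty set.\<close>

lemma semigap_le:
  assumes "subspace M" "\<And>u. u \<in> M \<Longrightarrow> norm u = 1 \<Longrightarrow> infdist u N \<le> d" "d \<ge> 0"
  shows "semigap M N \<le> d"
proof (cases "M = {0}")
  case False
  then obtain x where x: "x \<in> M" "x \<noteq> 0" using subspace_0[OF assms(1)] by blast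
  then have "(1 / norm x) *\<^sub>R x \<in> {u \<in> M. norm u = 1}" using assms(1) by (simp add: subspace_scale)
  then have "{u \<in> M. norm u = 1} \<noteq> {}" by blast
  then show ?thesis using False assms by (auto simp: semigap_def intro!: cSUP_least)
qed (use assms in \<open>simp add: semigap_def\<close>)

lemma semigap_nonneg:
  assumes "subspace M" "subspace N"
  shows "semigap M N \<ge> 0"
proof (cases "M = {0}")
  case False
  then obtain x where x: "x \<in> M" "x \<noteq> 0" using subspace_0[OF assms(1)] by blast
  then have "0 \<le> semigap M N * norm x"
    using infdist_le_semigap[OF assms x(1)] infdist_nonneg[of x N] by linarith
  then show ?thesis using x by (simp add: zero_le_mult_iff)
qed (simp add: semigap_def)

text \<open>Nearly optimal approximations \<open>n \<in> N\<close> of \<open>y\<close> satisfy \<open>\<parallel>n\<parallel> \<le> 2\<parallel>y\<parallel>\<close>; hence the factor 2.\<close>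

lemma infdist_le_add_semigap:
  assumes "subspace N" "subspace P"
  shows "infdist y P \<le> infdist y N + 2 * semigap N P * norm y"
proof (rule field_le_epsilon)
  fix e :: real assume e: "e > 0"
  define g where "g = semigap N P"
  have g: "g \<ge> 0" using assms by (simp add: g_def semigap_nonneg)
  \<comment> \<open>The slack enters once through \<open>dist y n\<close> and once, multiplied by
    \<open>g\<close>, through \<open>norm n\<close>; this choice makes the total
    \<open>e\<close>.\<close>
  define \<eta> where "\<eta> = e / (1 + g)"
  have \<eta>: "\<eta> > 0" "\<eta> * (1 + g) = e" using e g by (auto simp: \<eta>_def)
  have "infdist y N < infdist y N + \<eta>" using \<eta> by simp
  then obtain n where n: "n \<in> N" "dist y n < infdist y N + \<eta>"
    using infdist_lessD subspace_0[OF assms(1)] by blast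
  have "norm n \<le> norm y + dist y n" by (metis dist_norm norm_triangle_sub dist_commute)
  also have "\<dots> \<le> 2 * norm y + \<eta>" using n infdist_le_norm[OF assms(1), of y] by simp
  finally have nn: "norm n \<le> 2 * norm y + \<eta>" .
  have "infdist y P \<le> infdist n P + dist y n" by (rule infdist_triangle)
  also have "\<dots> \<le> g * norm n + dist y n"
    using infdist_le_semigap[OF assms n(1)] by (simp add: g_def)
  also have "\<dots> \<le> g * (2 * norm y + \<eta>) + (infdist y N + \<eta>)"
    using nn n g by (intro add_mono mult_left_mono) auto
  also have "\<dots> = infdist y N + 2 * g * norm y + \<eta> * (1 + g)" by (simp add: algebra_simps)
  finally show "infdist y P \<le> infdist y N + 2 * semigap N P * norm y + e"
    unfolding \<eta>(2) by (simp add: g_def)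
qed

lemma semigap_triangle:
  assumes "subspace M" "subspace N" "subspace P"
  shows "semigap M P \<le> semigap M N + 2 * semigap N P"
proof (rule semigap_le)
  fix u assume u: "u \<in> M" "norm u = 1"
  show "infdist u P \<le> semigap M N + 2 * semigap N P"
    using infdist_le_add_semigap[OF assms(2,3), of u] infdist_le_semigap[OF assms(1,2) u(1)] u
    by simp
qed (simp_all add: assms semigap_nonneg)

text \<open>In the two directions the factor 2 falls on different summands, so the maximum is
  bounded with 2 on both.\<close>

lemma gap_triangle:
  assumes "subspace M" "subspace N" "subspace P"
  shows "gap M P \<le> 2 * (gap M N + gap N P)"
  using semigap_triangle[OF assms] semigap_triangle[OF assms(3,2,1)]
    semigap_nonneg[OF assms(1,2)] semigap_nonneg[OF assms(3,2)]
  unfolding gap_def max_def by (auto split: if_splits)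

lemma gap_commute: "gap M N = gap N M"
  by (simp add: gap_def max.commute)

lemma gap_self: "subspace M \<Longrightarrow> gap M M = 0"
  using semigap_le[of M M 0] semigap_nonneg[of M M] by (simp add: gap_def)

text \<open>Riesz's lemma, in the contrapositive.\<close>

lemma subspace_eq_if_semigap_less_1:
  assumes "subspace M" "closed M" "subspace N" "M \<subseteq> N" "semigap N M < 1"
  shows "M = N"
proof (rule ccontr)
  assume "M \<noteq> N"
  then obtain x where x: "x \<in> N" "x \<notin> M" using assms(4) by blast
  define d where "d = infdist x M"
  have d: "d > 0" using in_closed_iff_infdist_zero[OF assms(2)] x subspace_0[OF assms(1)]
      infdist_nonneg[of x M] by (fastforce simp: d_def)
  \<comment> \<open>The midpoint lies strictly below 1 and is positive even when the semigap is 0,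
    so that division by it is possible.\<close>
  define r where "r = (semigap N M + 1) / 2"
  have r: "r < 1" "semigap N M \<le> r" "0 < r"
    using assms semigap_nonneg[OF assms(3,1)] by (auto simp: r_def)
  have "infdist x M < d / r" using d r by (simp add: d_def[symmetric] field_simps)
  then obtain m where m: "m \<in> M" "dist x m < d / r"
    using infdist_lessD subspace_0[OF assms(1)] by blast
  have "d \<le> infdist (x - m) M"
    unfolding d_def by (rule infdist_le_infdist_diff[OF assms(1) m(1)])
  also have "\<dots> \<le> semigap N M * norm (x - m)"
    using x m assms by (intro infdist_le_semigap) (auto intro: subspace_diff)
  also have "\<dots> \<le> r * norm (x - m)" using r by (intro mult_right_mono) auto
  also have "\<dots> < r * (d / r)" using m r by (simp add: dist_norm del: times_divide_eq_right)
  finally show False using r by simp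
qed

section \<open>Continuity with respect to the gap topology\<close>

context banach_space_over
begin

lemma real_subspace:
  assumes "module.subspace smul S"
  shows "Real_Vector_Spaces.subspace S"
proof -
  have "r *\<^sub>R x \<in> S" if "x \<in> S" for r x
    using assms that scale_of_real[of r x] by (metis subspace_scale)
  then show ?thesis
    using assms by (simp add: Real_Vector_Spaces.subspace_def subspace_def)
qed

lemma closed_subspacesD:
  assumes "M \<in> closed_subspaces smul"
  shows "subspace M" "Real_Vector_Spaces.subspace M" "closed M"
  using assms real_subspace by (auto simp: closed_subspaces_def)

text \<open>The approximate triangle inequality suffices to show that the points which have a gap ball
  inside a given gap ball form an open set.\<close>

lemma openin_gap_topology_ball:
  assumes M: "M \<in> closed_subspaces smul" and "\<epsilon> > 0"
  obtains U where "openin (gap_topology smul) U" "M \<in> U" "\<And>N. N \<in> U \<Longrightarrow> gap M N < \<epsilon>"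
proof
  let ?C = "closed_subspaces smul"
  let ?U = "{N \<in> ?C. \<exists>d>0. \<forall>P\<in>?C. gap N P < d \<longrightarrow> gap M P < \<epsilon>}"
  show "M \<in> ?U" using assms by auto
  show "gap M N < \<epsilon>" if "N \<in> ?U" for N
    using that gap_self[OF closed_subspacesD(2), of N] by auto
  have "\<exists>e>0. \<forall>P\<in>?C. gap N P < e \<longrightarrow> P \<in> ?U" if NU: "N \<in> ?U" for N
  proof -
    obtain d where N: "N \<in> ?C" and d: "d > 0" "\<And>P. P \<in> ?C \<Longrightarrow> gap N P < d \<Longrightarrow> gap M P < \<epsilon>"
      using NU by blast
    \<comment> \<open>Two steps of size below \<open>d / 4\<close> stay below \<open>d\<close>,
      given the factor 2 in \<open>gap_triangle\<close>.\<close>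
    have "gap M R < \<epsilon>" if "P \<in> ?C" "gap N P < d / 4" "R \<in> ?C" "gap P R < d / 4" for P R
    proof (rule d(2))
      have "gap N R \<le> 2 * (gap N P + gap P R)"
        by (intro gap_triangle closed_subspacesD(2) N that)
      then show "gap N R < d" using that by simp
    qed fact
    then have "\<forall>P\<in>?C. gap N P < d / 4 \<longrightarrow> P \<in> ?U"
      using d(1) by (blast intro: divide_pos_pos zero_less_numeral)
    then show ?thesis using d(1) by (meson divide_pos_pos zero_less_numeral)
  qed
  then show "openin (gap_topology smul) ?U"
    unfolding openin_gap_topology by (intro conjI ballI) auto
qed

lemma continuous_map_gapD:
  assumes "continuous_map J (gap_topology smul) F" "s \<in> topspace J" "\<epsilon> > 0"
  obtains U where "openin J U" "s \<in> U" "\<And>t. t \<in> U \<Longrightarrow> gap (F s) (F t) < \<epsilon>"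
proof -
  have "F s \<in> closed_subspaces smul"
    using continuous_map_image_subset_topspace[OF assms(1)] assms(2) by auto
  then obtain V where V: "openin (gap_topology smul) V" "F s \<in> V"
      "\<And>N. N \<in> V \<Longrightarrow> gap (F s) N < \<epsilon>"
    using openin_gap_topology_ball assms(3) by blast
  show thesis
  proof
    show "openin J {t \<in> topspace J. F t \<in> V}"
      using assms(1) V(1) by (rule openin_continuous_map_preimage)
  qed (use V assms(2) in auto)
qed

end

section \<open>Skew symmetric forms\<close>

lemma to_complex_0 [simp]: "to_complex 0 = 0"
  by (metis norm_eq_zero norm_to_complex)

lemma to_complex_eq_0_iff [simp]: "to_complex x = 0 \<longleftrightarrow> x = 0"
  by (metis norm_eq_zero norm_to_complex)

lemma to_complex_minus [simp]: "to_complex (- x) = - to_complex x"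
  using to_complex_add[of x "- x"] by (simp add: minus_unique)

lemma to_complex_diff: "to_complex (x - y) = to_complex x - to_complex y"
  using to_complex_add[of x "- y"] by simp

lemma kconj_0 [simp]: "kconj 0 = 0"
  by (metis complex_cnj_zero to_complex_0 to_complex_conj to_complex_eq_0_iff)

text \<open>For skew symmetric \<open>\<omega>\<close> the number under \<open>Re\<close> is real
  already; over the real field it is always 0.\<close>

definition energy :: "('a::banach \<Rightarrow> 'a \<Rightarrow> 'k::real_or_complex) \<Rightarrow> 'a \<Rightarrow> real" where
  "energy \<omega> x = Re (\<i> * to_complex (\<omega> x x))"

text \<open>Only the values \<open>h = -1, 0, 1\<close> are meaningful.\<close>

definition has_sign :: "('a::banach \<Rightarrow> 'a \<Rightarrow> 'k::real_or_complex) \<Rightarrow> 'a set \<Rightarrow> int \<Rightarrow> bool" where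
  "has_sign \<omega> S h \<longleftrightarrow> (h = 0 \<longleftrightarrow> S = annihilator \<omega> S) \<and>
     (\<forall>x\<in>annihilator \<omega> S - S. of_int h * energy \<omega> x > 0)"

locale skew_form = banach_space_over smul
  for smul :: "'k::real_or_complex \<Rightarrow> 'a::banach \<Rightarrow> 'a" +
  fixes \<omega> :: "'a \<Rightarrow> 'a \<Rightarrow> 'k"
  assumes sesq: "sesquilinear smul \<omega>"
    and bdd: "bounded_form \<omega>"
    and skew: "skew_symmetric \<omega>"
begin

lemma form_add: "\<omega> (x + x') y = \<omega> x y + \<omega> x' y" "\<omega> x (y + y') = \<omega> x y + \<omega> x y'"
  and form_smul: "\<omega> (smul c x) y = c * \<omega> x y" "\<omega> x (smul c y) = kconj c * \<omega> x y"
  using sesq by (auto simp: sesquilinear_def)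

lemma form_commute: "\<omega> y x = - kconj (\<omega> x y)"
  using skew unfolding skew_symmetric_def by blast

lemma form_eq_0_commute: "\<omega> x y = 0 \<Longrightarrow> \<omega> y x = 0"
  using form_commute[of y x] by simp

lemma form_zero: "\<omega> 0 y = 0" "\<omega> x 0 = 0"
  using form_add(1)[of 0 0 y] form_add(2)[of x 0 0] by simp_all

lemma form_minus: "\<omega> (- x) y = - \<omega> x y" "\<omega> x (- y) = - \<omega> x y"
  using form_add(1)[of x "- x" y] form_add(2)[of x y "- y"]
  by (simp_all add: form_zero add_eq_0_iff)

lemma form_diff: "\<omega> (x - x') y = \<omega> x y - \<omega> x' y" "\<omega> x (y - y') = \<omega> x y - \<omega> x y'"
  using form_add(1)[of x "- x'" y] form_add(2)[of x y "- y'"] by (simp_all add: form_minus)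

lemma form_map: "blinfun_apply (blinfun_apply (form_map \<omega>) x) y = \<omega> x y"
  by (rule form_map_apply[OF banach_space_over_axioms sesq bdd])

lemma form_bound: "norm (\<omega> x y) \<le> norm (form_map \<omega>) * norm x * norm y"
proof -
  have "norm (\<omega> x y) \<le> norm (blinfun_apply (form_map \<omega>) x) * norm y"
    using norm_blinfun[of "blinfun_apply (form_map \<omega>) x" y] by (simp add: form_map)
  also have "\<dots> \<le> norm (form_map \<omega>) * norm x * norm y"
    by (intro mult_right_mono norm_blinfun) auto
  finally show ?thesis .
qed

text \<open>Skew symmetry makes \<open>\<omega> x x\<close> purely imaginary, and the energy is its
  imaginary part up to sign.\<close>

lemma energy_eq_0_iff: "energy \<omega> x = 0 \<longleftrightarrow> \<omega> x x = 0"
proof -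
  have "to_complex (\<omega> x x) = - cnj (to_complex (\<omega> x x))"
    by (subst form_commute) (simp add: to_complex_conj)
  then have "Re (to_complex (\<omega> x x)) = 0" by (simp add: complex_eq_iff)
  then have "energy \<omega> x = 0 \<longleftrightarrow> to_complex (\<omega> x x) = 0"
    by (simp add: energy_def complex_eq_iff)
  then show ?thesis by simp
qed

text \<open>After multiplication by the imaginary unit, the two mixed terms are complex conjugates
  and so have the same real part.\<close>

lemma energy_add: "energy \<omega> (x + y) = energy \<omega> x + energy \<omega> y + 2 * Re (\<i> * to_complex (\<omega> x y))"
proof -
  have "to_complex (\<omega> y x) = - cnj (to_complex (\<omega> x y))"
    by (subst form_commute) (simp add: to_complex_conj)
  then show ?thesis by (simp add: energy_def form_add to_complex_add)
qed

lemma energy_smul: "energy \<omega> (smul c x) = (norm c)\<^sup>2 * energy \<omega> x"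
proof -
  have "to_complex (\<omega> (smul c x) (smul c x)) = (to_complex c * cnj (to_complex c)) * to_complex (\<omega> x x)"
    by (simp add: form_smul to_complex_mult to_complex_conj)
  also have "to_complex c * cnj (to_complex c) = of_real ((norm c)\<^sup>2)"
    unfolding norm_to_complex[of c, symmetric] by (rule complex_norm_square[symmetric])
  finally show ?thesis by (simp add: energy_def)
qed

text \<open>This bounds the error of moving the vector; \<open>energy_perturb_le\<close> bounds the
  error of changing the form.\<close>

lemma energy_diff_le:
  "\<bar>energy \<omega> x - energy \<omega> y\<bar> \<le> norm (form_map \<omega>) * (norm x + norm y) * norm (x - y)"
proof -
  have "energy \<omega> x - energy \<omega> y = Re (\<i> * to_complex (\<omega> (x - y) x + \<omega> y (x - y)))"
    by (simp add: energy_def form_diff to_complex_add to_complex_diff)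
  also have "\<bar>\<dots>\<bar> \<le> norm (\<omega> (x - y) x + \<omega> y (x - y))"
    using abs_Re_le_cmod[of "\<i> * to_complex (\<omega> (x - y) x + \<omega> y (x - y))"]
    by (simp add: norm_mult norm_to_complex)
  also have "\<dots> \<le> norm (form_map \<omega>) * norm (x - y) * norm x + norm (form_map \<omega>) * norm y * norm (x - y)"
    by (rule order_trans[OF norm_triangle_ineq add_mono[OF form_bound form_bound]])
  finally show ?thesis by (simp add: algebra_simps)
qed

lemma energy_perturb_le:
  assumes "skew_form smul \<omega>'"
  shows "\<bar>energy \<omega> x - energy \<omega>' x\<bar> \<le> norm (form_map \<omega> - form_map \<omega>') * (norm x)\<^sup>2"
proof -
  interpret p: skew_form smul \<omega>' by fact
  let ?D = "form_map \<omega> - form_map \<omega>'"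
  have D: "blinfun_apply (blinfun_apply ?D x) x = \<omega> x x - \<omega>' x x"
    by (simp add: minus_blinfun.rep_eq form_map p.form_map)
  have "\<bar>energy \<omega> x - energy \<omega>' x\<bar> = \<bar>Re (\<i> * to_complex (\<omega> x x - \<omega>' x x))\<bar>"
    by (simp add: energy_def to_complex_diff)
  also have "\<dots> \<le> norm (\<omega> x x - \<omega>' x x)"
    using abs_Re_le_cmod[of "\<i> * to_complex (\<omega> x x - \<omega>' x x)"]
    by (simp add: norm_mult norm_to_complex)
  also have "\<dots> \<le> norm (blinfun_apply ?D x) * norm x"
    unfolding D[symmetric] by (rule norm_blinfun)
  also have "\<dots> \<le> norm ?D * norm x * norm x"
    by (intro mult_right_mono norm_blinfun) auto
  finally show ?thesis by (simp add: power2_eq_square mult.assoc)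
qed

lemma subspace_annihilator: "subspace (annihilator \<omega> S)"
  by (rule subspaceI) (auto simp: annihilator_def form_zero form_add form_smul)

text \<open>For isotropic \<open>S\<close> this says that the energy descends to the quotient of the
  annihilator by \<open>S\<close>.\<close>

lemma energy_add_annihilator:
  assumes "m \<in> S" "m \<in> annihilator \<omega> S" "x \<in> annihilator \<omega> S"
  shows "energy \<omega> (x + m) = energy \<omega> x"
proof -
  have "\<omega> m m = 0" "\<omega> x m = 0"
    using assms form_eq_0_commute by (auto simp: annihilator_def)
  then show ?thesis by (simp add: energy_add energy_eq_0_iff)
qed

section \<open>Maximal isotropic subspaces\<close>

text \<open>Adding the line through \<open>x\<close> keeps \<open>S\<close> isotropic: mixed terms
  vanish since \<open>x\<close> annihilates \<open>S\<close>, and \<open>\<omega> x x = 0\<close> by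
  the zero energy. Maximality then puts \<open>x\<close> into \<open>S\<close>.\<close>

lemma maximal_isotropic_energy_eq_0:
  assumes S: "maximal_isotropic smul \<omega> S" and x: "x \<in> annihilator \<omega> S" "energy \<omega> x = 0"
  shows "x \<in> S"
proof -
  have S': "subspace S" "S \<subseteq> annihilator \<omega> S"
    using S by (auto simp: maximal_isotropic_def isotropic_def)
  let ?T = "{u + v |u v. u \<in> S \<and> v \<in> span {x}}"
  have "subspace ?T" using S' by (intro subspace_sums) auto
  moreover have "\<omega> (u + smul c x) (v + smul d x) = 0" if "u \<in> S" "v \<in> S" for u v c d
    using that x S' form_eq_0_commute[of v x]
    by (auto simp: form_add form_smul annihilator_def energy_eq_0_iff)
  then have "?T \<subseteq> annihilator \<omega> ?T"
    unfolding annihilator_def span_singleton by blast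
  moreover have "S \<subseteq> ?T"
    using span_zero by force
  ultimately have "?T = S" using S by (simp add: maximal_isotropic_def isotropic_def)
  moreover have "x \<in> ?T" using span_base[of x "{x}"] subspace_0[OF S'(1)] by force
  ultimately show ?thesis by simp
qed

text \<open>A vector of the double annihilator also lies in the annihilator, hence is orthogonal to
  itself and has energy 0.\<close>

lemma annihilator_annihilator_maximal:
  assumes S: "maximal_isotropic smul \<omega> S"
  shows "annihilator \<omega> (annihilator \<omega> S) = S"
proof
  have S': "S \<subseteq> annihilator \<omega> S"
    using S by (auto simp: maximal_isotropic_def isotropic_def)
  show "S \<subseteq> annihilator \<omega> (annihilator \<omega> S)"
    using form_eq_0_commute by (auto simp: annihilator_def)
  show "annihilator \<omega> (annihilator \<omega> S) \<subseteq> S"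
  proof
    fix x assume x: "x \<in> annihilator \<omega> (annihilator \<omega> S)"
    then have "x \<in> annihilator \<omega> S" using S' by (auto simp: annihilator_def)
    moreover from this x have "energy \<omega> x = 0" by (auto simp: energy_eq_0_iff annihilator_def)
    ultimately show "x \<in> S" by (rule maximal_isotropic_energy_eq_0[OF S])
  qed
qed

text \<open>If the energy took both signs outside \<open>S\<close>, it would vanish at some \<open>x + t y\<close>; then
  \<open>x \<equiv> - t y\<close> modulo \<open>S\<close>, and \<open>x\<close> and \<open>y\<close> would have energies of the same sign.\<close>

lemma maximal_isotropic_same_sign:
  assumes S: "maximal_isotropic smul \<omega> S"
    and x: "x \<in> annihilator \<omega> S" "energy \<omega> x > 0"
    and y: "y \<in> annihilator \<omega> S"
  shows "energy \<omega> y \<ge> 0"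
proof (rule ccontr)
  assume "\<not> energy \<omega> y \<ge> 0"
  then have neg: "energy \<omega> y < 0" by simp
  have S': "subspace S" "S \<subseteq> annihilator \<omega> S"
    using S by (auto simp: maximal_isotropic_def isotropic_def)
  define a b c where "a = energy \<omega> y" and "b = 2 * Re (\<i> * to_complex (\<omega> x y))"
    and "c = energy \<omega> x"
  have expand: "energy \<omega> (x + t *\<^sub>R y) = a * t\<^sup>2 + b * t + c" for t
  proof -
    have "\<omega> x (t *\<^sub>R y) = kconj (of_real t) * \<omega> x y"
      by (simp add: form_smul flip: scale_of_real)
    moreover have "to_complex (of_real t :: 'k) = of_real t"
      by (simp add: of_real_def to_complex_scaleR to_complex_one)
    ultimately have "Re (\<i> * to_complex (\<omega> x (t *\<^sub>R y))) = t * Re (\<i> * to_complex (\<omega> x y))"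
      by (simp add: to_complex_mult to_complex_conj)
    moreover have "energy \<omega> (t *\<^sub>R y) = t\<^sup>2 * energy \<omega> y"
      using energy_smul[of "of_real t" y] by (simp add: scale_of_real)
    ultimately show ?thesis by (simp add: energy_add a_def b_def c_def algebra_simps)
  qed
  have disc: "discrim a b c \<ge> 0"
  proof -
    have "a * c < 0" using neg x(2) by (simp add: a_def c_def mult_less_0_iff)
    moreover have "0 \<le> b\<^sup>2" by simp
    ultimately show ?thesis unfolding discrim_def by linarith
  qed
  define t where "t = (- b + sqrt (discrim a b c)) / (2 * a)"
  have "a * t\<^sup>2 + b * t + c = 0"
    using discriminant_nonneg[of a b c t] disc neg by (simp add: t_def a_def)
  then have 0: "energy \<omega> (x + t *\<^sub>R y) = 0" by (simp add: expand)
  have ty: "t *\<^sub>R y \<in> annihilator \<omega> S"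
    using y subspace_annihilator subspace_scale by (metis scale_of_real)
  have "x + t *\<^sub>R y \<in> S"
    using x ty 0 subspace_annihilator
    by (intro maximal_isotropic_energy_eq_0[OF S]) (auto intro: subspace_add)
  then have m: "x + t *\<^sub>R y \<in> S" "x + t *\<^sub>R y \<in> annihilator \<omega> S" using S' by auto
  have "- (t *\<^sub>R y) \<in> annihilator \<omega> S"
    using ty subspace_annihilator by (rule subspace_neg[rotated])
  then have "energy \<omega> (- (t *\<^sub>R y) + (x + t *\<^sub>R y)) = energy \<omega> (- (t *\<^sub>R y))"
    using m by (intro energy_add_annihilator)
  then have "energy \<omega> x = energy \<omega> (smul (of_real (- t)) y)"
    by (simp add: scale_of_real)
  also have "\<dots> \<le> 0" using neg unfolding energy_smul by (simp add: mult_le_0_iff)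
  finally show False using x by simp
qed

lemma maximal_isotropic_has_sign:
  assumes S: "maximal_isotropic smul \<omega> S"
  obtains h where "h \<in> {-1, 0, 1}" "has_sign \<omega> S h"
proof (cases "S = annihilator \<omega> S")
  case True
  then have "has_sign \<omega> S 0" unfolding has_sign_def by blast
  then show ?thesis using that by blast
next
  case False
  have nz: "energy \<omega> x \<noteq> 0" if "x \<in> annihilator \<omega> S - S" for x
    using maximal_isotropic_energy_eq_0[OF S] that by blast
  have "S \<subseteq> annihilator \<omega> S"
    using S by (auto simp: maximal_isotropic_def isotropic_def)
  then obtain z where z: "z \<in> annihilator \<omega> S - S" using False by blast
  show ?thesis
  proof (cases "energy \<omega> z > 0")
    case True
    have "energy \<omega> x > 0" if "x \<in> annihilator \<omega> S - S" for x
      using maximal_isotropic_same_sign[OF S, of z x] z True that nz[OF that] by force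
    then show ?thesis using that[of 1] False by (simp add: has_sign_def)
  next
    case neg: False
    \<comment> \<open>The roles are exchanged here: positive energy at \<open>x\<close> would force
      nonnegative energy at \<open>z\<close>.\<close>
    have "energy \<omega> x < 0" if "x \<in> annihilator \<omega> S - S" for x
      using maximal_isotropic_same_sign[OF S, of x z] z neg that nz[OF that] nz[OF z] by force
    then show ?thesis using that[of "-1"] False by (simp add: has_sign_def)
  qed
qed

text \<open>Every vector of a larger isotropic subspace annihilates \<open>S\<close> and has energy
  0, which the strict sign rules out outside \<open>S\<close>.\<close>

lemma has_sign_maximal_isotropic:
  assumes "isotropic smul \<omega> S" "has_sign \<omega> S h"
  shows "maximal_isotropic smul \<omega> S"
  unfolding maximal_isotropic_def
proof (intro conjI allI impI)
  fix T assume T: "isotropic smul \<omega> T \<and> S \<subseteq> T"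
  have "x \<in> S" if "x \<in> T" for x
  proof (rule ccontr)
    assume "x \<notin> S"
    moreover have "x \<in> annihilator \<omega> S" "energy \<omega> x = 0"
      using T that by (auto simp: isotropic_def annihilator_def energy_eq_0_iff)
    ultimately show False
      using assms(2) unfolding has_sign_def by (metis DiffI less_irrefl mult_zero_right)
  qed
  then show "T = S" using T by blast
qed fact

section \<open>The reduced form, its sign and its minimum modulus\<close>

lemma coset_eq_iff:
  assumes "subspace S"
  shows "coset S x = S \<longleftrightarrow> x \<in> S"
proof
  assume "coset S x = S"
  then show "x \<in> S" using subspace_0[OF assms] by (force simp: coset_def)
next
  assume x: "x \<in> S"
  have "y \<in> (+) x ` S" if "y \<in> S" for y
    using assms x that by (intro image_eqI[of _ _ "y - x"]) (auto intro: subspace_diff)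
  then show "coset S x = S" using assms x by (auto simp: coset_def intro: subspace_add)
qed

text \<open>Well-definedness of the reduced form allows passing to representatives; the reality of
  the values follows from skew symmetry.\<close>

lemma positive_definite_on_reduced:
  assumes S: "isotropic smul \<omega> S" and h: "h = 1 \<or> h = - 1"
  shows "positive_definite_on (reduced_space \<omega> S) S
           (\<lambda>A B. of_int h * \<i> * to_complex (reduced_form \<omega> A B)) \<longleftrightarrow>
         (\<forall>x\<in>annihilator \<omega> S - S. of_int h * energy \<omega> x > 0)"
proof -
  have sub: "subspace S" using S by (simp add: isotropic_def)
  have val: "to_complex (reduced_form \<omega> (coset S x) (coset S x)) = to_complex (\<omega> x x)"
    if "x \<in> annihilator \<omega> S" for x
    using reduced_form_coset[OF banach_space_over_axioms sesq skew S that that] by simp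
  have im: "Im (\<i> * to_complex (\<omega> x x)) = 0" for x
  proof -
    have "to_complex (\<omega> x x) = - cnj (to_complex (\<omega> x x))"
      by (subst form_commute) (simp add: to_complex_conj)
    then show ?thesis by (simp add: complex_eq_iff)
  qed
  have "of_int h * \<i> * to_complex (\<omega> x x) \<in> \<real> \<and> Re (of_int h * \<i> * to_complex (\<omega> x x)) > 0 \<longleftrightarrow>
      of_int h * energy \<omega> x > 0" for x
    using h im[of x] by (auto simp: energy_def complex_is_Real_iff)
  then show ?thesis
    unfolding positive_definite_on_def reduced_space_def
    by (auto simp: coset_eq_iff[OF sub] val)
qed

lemma has_sign_form_sign:
  assumes S: "isotropic smul \<omega> S" and h: "h \<in> {-1, 0, 1}" "has_sign \<omega> S h"
  shows "form_sign \<omega> S = h"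
proof (cases "S = annihilator \<omega> S")
  case True
  then show ?thesis using h by (auto simp: form_sign_def has_sign_def)
next
  case False
  then obtain z where z: "z \<in> annihilator \<omega> S - S" using S by (auto simp: isotropic_def)
  have "h = 1 \<or> h = -1" using h False by (auto simp: has_sign_def)
  moreover have
    "positive_definite_on (reduced_space \<omega> S) S (\<lambda>A B. \<i> * to_complex (reduced_form \<omega> A B)) \<longleftrightarrow>
      (\<forall>x\<in>annihilator \<omega> S - S. energy \<omega> x > 0)"
    "positive_definite_on (reduced_space \<omega> S) S (\<lambda>A B. - \<i> * to_complex (reduced_form \<omega> A B)) \<longleftrightarrow>
      (\<forall>x\<in>annihilator \<omega> S - S. - energy \<omega> x > 0)"
    using positive_definite_on_reduced[OF S, of 1] positive_definite_on_reduced[OF S, of "-1"]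
    by simp_all
  moreover have "\<forall>x\<in>annihilator \<omega> S - S. of_int h * energy \<omega> x > 0"
    using h(2) by (simp add: has_sign_def)
  \<comment> \<open>\<open>form_sign\<close> tests positive definiteness first, so for
    \<open>h = - 1\<close> that test must be shown to fail; \<open>z\<close> is the
    counterexample.\<close>
  moreover from bspec[OF this z] have "h = - 1 \<Longrightarrow> \<not> energy \<omega> z > 0" by simp
  then have "h = - 1 \<Longrightarrow> \<not> (\<forall>x\<in>annihilator \<omega> S - S. energy \<omega> x > 0)" using z by blast
  ultimately show ?thesis
    using False unfolding form_sign_def by auto
qed

text \<open>The sign bounds the quotients below by 0, so their infimum is a lower bound and the
  denominator can be cleared. This is the form in which the positivity of the modulus is
  used.\<close>

lemma reduced_min_modulus_coercive:
  assumes S: "isotropic smul \<omega> S" and h: "h \<in> {-1, 0, 1}" "has_sign \<omega> S h"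
    and pos: "reduced_min_modulus \<omega> S > 0" and x: "x \<in> annihilator \<omega> S"
  shows "reduced_min_modulus \<omega> S * (infdist x S)\<^sup>2 \<le> of_int h * energy \<omega> x"
proof (cases "x \<in> S")
  case True
  then have "energy \<omega> x = 0" using x by (simp add: energy_eq_0_iff annihilator_def)
  then show ?thesis using True by simp
next
  case False
  let ?f = "\<lambda>x. Re (\<i> * of_int (form_sign \<omega> S) * to_complex (\<omega> x x)) / (infdist x S)\<^sup>2"
  have f: "?f y = of_int h * energy \<omega> y / (infdist y S)\<^sup>2" for y
    using has_sign_form_sign[OF S h] by (simp add: energy_def)
  have "bdd_below (?f ` (annihilator \<omega> S - S))"
    unfolding f using h(2) by (intro bdd_belowI2[of _ 0] divide_nonneg_nonneg) (auto simp: has_sign_def less_imp_le)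
  then have "(INF y \<in> annihilator \<omega> S - S. ?f y) \<le> ?f x"
    using x False by (intro cINF_lower) auto
  moreover have "S \<noteq> annihilator \<omega> S" using x False by blast
  ultimately have "reduced_min_modulus \<omega> S \<le> of_int h * energy \<omega> x / (infdist x S)\<^sup>2"
    by (simp only: reduced_min_modulus_def f if_False)
  \<comment> \<open>At distance 0 the quotient would be 0 by the convention for division,
    contradicting \<open>pos\<close>.\<close>
  moreover from this have "(infdist x S)\<^sup>2 > 0" using pos by (cases "infdist x S = 0") auto
  ultimately show ?thesis by (simp add: pos_le_divide_eq)
qed

end

section \<open>Stability of the sign\<close>

text \<open>A single radius for the four continuous data: the form, the subspace, its annihilator
  and its double annihilator.\<close>

definition near ::
    "real \<Rightarrow> ('a::banach \<Rightarrow> 'a \<Rightarrow> 'k::real_or_complex) \<Rightarrow> 'a set \<Rightarrow> ('a \<Rightarrow> 'a \<Rightarrow> 'k) \<Rightarrow> 'a set \<Rightarrow> bool" where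
  "near \<epsilon> \<omega> S \<omega>' S' \<longleftrightarrow> norm (form_map \<omega> - form_map \<omega>') < \<epsilon> \<and> gap S S' < \<epsilon> \<and>
     gap (annihilator \<omega> S) (annihilator \<omega>' S') < \<epsilon> \<and>
     gap (annihilator \<omega> (annihilator \<omega> S)) (annihilator \<omega>' (annihilator \<omega>' S')) < \<epsilon>"

lemma near_sym: "near \<epsilon> \<omega> S \<omega>' S' \<Longrightarrow> near \<epsilon> \<omega>' S' \<omega> S"
  by (simp add: near_def gap_commute norm_minus_commute)

lemma near_mono: "near \<epsilon> \<omega> S \<omega>' S' \<Longrightarrow> \<epsilon> \<le> \<epsilon>' \<Longrightarrow> near \<epsilon>' \<omega> S \<omega>' S'"
  by (auto simp: near_def)

lemma near_semigapD:
  assumes "near \<epsilon> \<omega> S \<omega>' S'"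
  shows "semigap S S' < \<epsilon>" "semigap S' S < \<epsilon>"
    "semigap (annihilator \<omega> S) (annihilator \<omega>' S') < \<epsilon>"
    "semigap (annihilator \<omega>' S') (annihilator \<omega> S) < \<epsilon>"
    "semigap (annihilator \<omega> (annihilator \<omega> S)) (annihilator \<omega>' (annihilator \<omega>' S')) < \<epsilon>"
  using assms by (auto simp: near_def gap_def)

locale closed_isotropic = skew_form smul \<omega>
  for smul :: "'k::real_or_complex \<Rightarrow> 'a::banach \<Rightarrow> 'a" and \<omega> +
  fixes S :: "'a set"
  assumes S_closed: "S \<in> closed_subspaces smul"
    and S_le: "S \<subseteq> annihilator \<omega> S"
begin

lemma isotropic: "isotropic smul \<omega> S"
  using S_le closed_subspacesD[OF S_closed] by (simp add: isotropic_def)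

lemma real_subspace_annihilator: "Real_Vector_Spaces.subspace (annihilator \<omega> T)"
  by (rule real_subspace[OF subspace_annihilator])

lemmas real_subspace_S = closed_subspacesD(2)[OF S_closed]

text \<open>The annihilator of \<open>S'\<close> is close to that of \<open>S\<close>, which is
  \<open>S\<close>, which is close to \<open>S'\<close>: the semigap is below
  \<open>1/8 + 2/8\<close>.\<close>

lemma eq_annihilator_perturb:
  assumes eq: "S = annihilator \<omega> S" and "closed_isotropic smul \<omega>' S'"
    and near: "near (1/8) \<omega> S \<omega>' S'"
  shows "S' = annihilator \<omega>' S'"
proof -
  interpret p: closed_isotropic smul \<omega>' S' by fact
  have "semigap (annihilator \<omega>' S') S'
      \<le> semigap (annihilator \<omega>' S') (annihilator \<omega> S) + 2 * semigap (annihilator \<omega> S) S'"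
    by (intro semigap_triangle real_subspace_annihilator p.real_subspace_annihilator p.real_subspace_S)
  also have "\<dots> < 1"
    using near_semigapD[OF near] unfolding eq[symmetric] by simp
  finally show ?thesis
    by (intro subspace_eq_if_semigap_less_1 p.real_subspace_annihilator p.real_subspace_S
        closed_subspacesD(3)[OF p.S_closed] p.S_le)
qed

text \<open>Openness. For \<open>h \<noteq> 0\<close> a vector outside \<open>S'\<close> is moved
  into the annihilator of \<open>S\<close>, where coercivity bounds its energy below by more than
  the move and the change of form can cost.\<close>

lemma has_sign_perturb:
  assumes h: "h \<in> {-1, 0, 1}" "has_sign \<omega> S h"
    and pos: "h \<noteq> 0 \<Longrightarrow> reduced_min_modulus \<omega> S > 0"
  obtains \<epsilon> where "\<epsilon> > 0"
    "\<And>\<omega>' S'. closed_isotropic smul \<omega>' S' \<Longrightarrow> near \<epsilon> \<omega> S \<omega>' S' \<Longrightarrow> has_sign \<omega>' S' h"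
proof (cases "h = 0")
  case True
  then have "S = annihilator \<omega> S" using h(2) by (simp add: has_sign_def)
  then have "has_sign \<omega>' S' h" if "closed_isotropic smul \<omega>' S'" "near (1/8) \<omega> S \<omega>' S'" for \<omega>' S'
    using eq_annihilator_perturb[OF _ that] True unfolding has_sign_def by blast
  then show ?thesis using that[of "1/8"] by simp
next
  case False
  define \<gamma> where "\<gamma> = reduced_min_modulus \<omega> S"
  define C where "C = norm (form_map \<omega>)"
  \<comment> \<open>The bound \<open>1/20\<close> keeps the moved vector at distance at least
    \<open>d / 2\<close> from \<open>S\<close>. The energy error is at most
    \<open>(4 + 12 * C) * \<epsilon> * d\<^sup>2\<close>, and the 5 pushes it below the lower bound
    \<open>\<gamma> * d\<^sup>2 / 4\<close>.\<close>
  define \<epsilon> where "\<epsilon> = min (1/20) (\<gamma> / (5 * (4 + 12 * C)))"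
  have \<gamma>: "\<gamma> > 0" using pos False by (simp add: \<gamma>_def)
  have C: "C \<ge> 0" by (simp add: C_def)
  have D: "5 * (4 + 12 * C) > 0" using C by simp
  then have "\<gamma> / (5 * (4 + 12 * C)) > 0" using \<gamma> by (rule divide_pos_pos[rotated])
  then have \<epsilon>: "\<epsilon> > 0" "\<epsilon> \<le> 1/20" "\<epsilon> \<le> \<gamma> / (5 * (4 + 12 * C))"
    unfolding \<epsilon>_def by linarith+
  have \<epsilon>\<gamma>: "\<epsilon> * (5 * (4 + 12 * C)) \<le> \<gamma>"
    using \<epsilon>(3) unfolding pos_le_divide_eq[OF D] .
  have S_ne: "S \<noteq> annihilator \<omega> S" using h(2) False by (simp add: has_sign_def)
  have "has_sign \<omega>' S' h" if p: "closed_isotropic smul \<omega>' S'" and near: "near \<epsilon> \<omega> S \<omega>' S'" for \<omega>' S'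
  proof -
    interpret p: closed_isotropic smul \<omega>' S' by fact
    \<comment> \<open>Stability of equality is applied backwards: equality for \<open>S'\<close>
      would give equality for \<open>S\<close>.\<close>
    have "near (1/8) \<omega>' S' \<omega> S"
      using near \<epsilon> by (auto intro: near_mono near_sym)
    then have "S' \<noteq> annihilator \<omega>' S'"
      using p.eq_annihilator_perturb[OF _ closed_isotropic_axioms] S_ne by blast
    moreover have "of_int h * energy \<omega>' x > 0" if x: "x \<in> annihilator \<omega>' S'" "x \<notin> S'" for x
    proof -
      define d where "d = infdist x S'"
      have d: "d > 0"
        using in_closed_iff_infdist_zero[OF closed_subspacesD(3)[OF p.S_closed]] x infdist_nonneg[of x S']
          Real_Vector_Spaces.subspace_0[OF p.real_subspace_S]
        by (fastforce simp: d_def)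
      then have "infdist x S' < 2 * d" by (simp add: d_def)
      then obtain m where m: "m \<in> S'" "dist x m < 2 * d"
        using infdist_lessD Real_Vector_Spaces.subspace_0[OF p.real_subspace_S] by blast
      \<comment> \<open>This representative of \<open>x\<close> modulo \<open>S'\<close> has the
        same energy and norm comparable with \<open>d\<close>, so all errors are of order
        \<open>d\<^sup>2\<close>.\<close>
      define z where "z = x - m"
      have m': "- m \<in> S'" using m p.real_subspace_S by (simp add: Real_Vector_Spaces.subspace_neg)
      have z: "z \<in> annihilator \<omega>' S'" "energy \<omega>' z = energy \<omega>' x" "norm z \<le> 2 * d"
        using p.energy_add_annihilator[OF m' _ x(1)] m m' p.S_le x(1)
          Real_Vector_Spaces.subspace_diff[OF p.real_subspace_annihilator x(1)]
        by (auto simp: z_def dist_norm)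
      have "d \<le> infdist z S'"
        unfolding d_def z_def by (rule infdist_le_infdist_diff[OF p.real_subspace_S m(1)])
      obtain y where y: "y \<in> annihilator \<omega> S" "norm (z - y) \<le> \<epsilon> * norm z"
        using semigap_approx[OF p.real_subspace_annihilator real_subspace_annihilator z(1)
            near_semigapD(4)[OF near]] by blast
      have zy: "norm (z - y) \<le> 2 * \<epsilon> * d"
        using order_trans[OF y(2) mult_left_mono[OF z(3)]] \<epsilon>(1) by simp
      have \<epsilon>d: "\<epsilon> * d \<le> 1/20 * d" using \<epsilon>(2) d by (intro mult_right_mono) auto
      have "norm y \<le> norm z + norm (z - y)" by (metis norm_triangle_sub norm_minus_commute)
      also have "\<dots> \<le> 2 * d + 2 * (1/20) * d"
        using zy z(3) \<epsilon>d by linarith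
      finally have ny: "norm y \<le> 4 * d" using d by simp
      have "infdist z S' \<le> infdist y S' + dist z y" by (rule infdist_triangle)
      also have "infdist y S' \<le> infdist y S + 2 * semigap S S' * norm y"
        by (rule infdist_le_add_semigap[OF real_subspace_S p.real_subspace_S])
      also have "\<dots> \<le> infdist y S + 2 * \<epsilon> * (4 * d)"
        using near_semigapD(1)[OF near] ny semigap_nonneg[OF real_subspace_S p.real_subspace_S] \<epsilon>(1)
        by (intro add_left_mono mult_mono) auto
      finally have "d \<le> infdist y S + 10 * (\<epsilon> * d)"
        using \<open>d \<le> infdist z S'\<close> zy by (simp add: dist_norm)
      then have "d / 2 \<le> infdist y S" using \<epsilon>d by simp
      then have "\<gamma> * (d / 2)\<^sup>2 \<le> \<gamma> * (infdist y S)\<^sup>2"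
        using d \<gamma> by (intro mult_left_mono power_mono) auto
      also have "\<dots> \<le> of_int h * energy \<omega> y"
        unfolding \<gamma>_def using reduced_min_modulus_coercive[OF isotropic h _ y(1)] pos False by simp
      finally have lower: "\<gamma> * (d / 2)\<^sup>2 \<le> of_int h * energy \<omega> y" .
      have "\<bar>energy \<omega> z - energy \<omega>' z\<bar> \<le> norm (form_map \<omega> - form_map \<omega>') * (norm z)\<^sup>2"
        by (rule energy_perturb_le[OF p.skew_form_axioms])
      also have "\<dots> \<le> \<epsilon> * (2 * d)\<^sup>2"
        using near z(3) \<epsilon>(1) by (intro mult_mono power_mono) (auto simp: near_def)
      finally have 1: "\<bar>energy \<omega> z - energy \<omega>' z\<bar> \<le> \<epsilon> * (2 * d)\<^sup>2" .
      have "\<bar>energy \<omega> z - energy \<omega> y\<bar> \<le> C * (norm z + norm y) * norm (z - y)"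
        unfolding C_def by (rule energy_diff_le)
      also have "\<dots> \<le> C * (2 * d + 4 * d) * (2 * \<epsilon> * d)"
        using z(3) ny zy C d by (intro mult_mono add_mono mult_nonneg_nonneg) auto
      finally have "\<bar>energy \<omega> z - energy \<omega> y\<bar> \<le> C * (2 * d + 4 * d) * (2 * \<epsilon> * d)" .
      with 1 have "\<bar>energy \<omega>' z - energy \<omega> y\<bar> \<le> \<epsilon> * (2 * d)\<^sup>2 + C * (2 * d + 4 * d) * (2 * \<epsilon> * d)"
        by simp
      also have "\<dots> = (\<epsilon> * (5 * (4 + 12 * C))) * d\<^sup>2 / 5"
        by (simp add: power2_eq_square algebra_simps)
      also have "\<dots> \<le> \<gamma> * d\<^sup>2 / 5"
        using \<epsilon>\<gamma> by (intro divide_right_mono mult_right_mono) auto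
      also have "\<dots> < \<gamma> * (d / 2)\<^sup>2" using \<gamma> d by (simp add: power2_eq_square)
      finally have "\<bar>energy \<omega>' z - energy \<omega> y\<bar> < of_int h * energy \<omega> y" using lower by simp
      then have "of_int h * energy \<omega>' z > 0" using h(1) False by auto
      then show ?thesis by (simp add: z(2))
    qed
    ultimately show ?thesis using False unfolding has_sign_def by blast
  qed
  then show ?thesis using that \<epsilon>(1) by blast
qed

text \<open>Approximating \<open>x\<close> by \<open>y\<close> in a nearby annihilator changes the
  energy by at most \<open>\<epsilon> * K\<close>, where \<open>K\<close> depends only on
  \<open>x\<close> and \<open>\<omega>\<close>, not on the approximating pair.\<close>

lemma energy_nonneg_limit:
  fixes r :: real
  assumes r: "\<bar>r\<bar> \<le> 1" and x: "x \<in> annihilator \<omega> S"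
    and approx: "\<And>\<epsilon>. \<epsilon> > 0 \<Longrightarrow> \<exists>\<omega>' S'. closed_isotropic smul \<omega>' S' \<and> near \<epsilon> \<omega> S \<omega>' S' \<and>
      (\<forall>y\<in>annihilator \<omega>' S'. r * energy \<omega>' y \<ge> 0)"
  shows "r * energy \<omega> x \<ge> 0"
proof -
  define K where "K = 4 * (norm x)\<^sup>2 + 3 * norm (form_map \<omega>) * (norm x)\<^sup>2"
  have bound: "- (\<epsilon> * K) \<le> r * energy \<omega> x" if \<epsilon>: "0 < \<epsilon>" "\<epsilon> < 1" for \<epsilon>
  proof -
    obtain \<omega>' S' where p: "closed_isotropic smul \<omega>' S'" and near: "near \<epsilon> \<omega> S \<omega>' S'"
      and nn: "\<And>y. y \<in> annihilator \<omega>' S' \<Longrightarrow> r * energy \<omega>' y \<ge> 0"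
      using approx[OF \<epsilon>(1)] by blast
    interpret p: closed_isotropic smul \<omega>' S' by fact
    obtain y where y: "y \<in> annihilator \<omega>' S'" "norm (x - y) \<le> \<epsilon> * norm x"
      using semigap_approx[OF real_subspace_annihilator p.real_subspace_annihilator x
          near_semigapD(3)[OF near]] by blast
    have "norm y \<le> norm x + norm (x - y)" by (metis norm_triangle_sub norm_minus_commute)
    moreover have "\<epsilon> * norm x \<le> 1 * norm x" using \<epsilon> by (intro mult_right_mono) auto
    ultimately have ny: "norm y \<le> 2 * norm x" using y(2) by simp
    have "\<bar>energy \<omega> y - energy \<omega>' y\<bar> \<le> norm (form_map \<omega> - form_map \<omega>') * (norm y)\<^sup>2"
      by (rule energy_perturb_le[OF p.skew_form_axioms])
    also have "\<dots> \<le> \<epsilon> * (2 * norm x)\<^sup>2"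
      using near ny \<epsilon>(1) by (intro mult_mono power_mono) (auto simp: near_def)
    finally have 1: "\<bar>energy \<omega> y - energy \<omega>' y\<bar> \<le> \<epsilon> * (2 * norm x)\<^sup>2" .
    have "\<bar>energy \<omega> x - energy \<omega> y\<bar> \<le> norm (form_map \<omega>) * (norm x + norm y) * norm (x - y)"
      by (rule energy_diff_le)
    also have "\<dots> \<le> norm (form_map \<omega>) * (norm x + 2 * norm x) * (\<epsilon> * norm x)"
      using ny y(2) by (intro mult_mono add_mono mult_nonneg_nonneg) auto
    finally have "\<bar>energy \<omega> x - energy \<omega>' y\<bar>
        \<le> \<epsilon> * (2 * norm x)\<^sup>2 + norm (form_map \<omega>) * (norm x + 2 * norm x) * (\<epsilon> * norm x)"
      using 1 by simp
    also have "\<dots> = \<epsilon> * K" by (simp add: K_def power2_eq_square algebra_simps)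
    finally have "\<bar>energy \<omega> x - energy \<omega>' y\<bar> \<le> \<epsilon> * K" .
    moreover have "\<bar>r * (energy \<omega> x - energy \<omega>' y)\<bar> \<le> 1 * \<bar>energy \<omega> x - energy \<omega>' y\<bar>"
      unfolding abs_mult using r by (intro mult_right_mono) auto
    ultimately have "\<bar>r * energy \<omega> x - r * energy \<omega>' y\<bar> \<le> \<epsilon> * K"
      by (simp add: right_diff_distrib)
    then show ?thesis using nn[OF y(1)] by simp
  qed
  show ?thesis
  proof (rule ccontr)
    assume "\<not> r * energy \<omega> x \<ge> 0"
    then have neg: "r * energy \<omega> x < 0" by simp
    have K: "K \<ge> 0" by (simp add: K_def)
    define a where "a = - (r * energy \<omega> x)"
    \<comment> \<open>Chosen so that \<open>\<epsilon> * K\<close> is at most half of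
      \<open>a\<close>; \<open>K + 1\<close> avoids division by 0.\<close>
    define \<epsilon> where "\<epsilon> = min (1/2) (a / (2 * (K + 1)))"
    have "a > 0" using neg by (simp add: a_def)
    then have "a / (2 * (K + 1)) > 0" using K by (intro divide_pos_pos) auto
    then have \<epsilon>: "0 < \<epsilon>" "\<epsilon> < 1" "\<epsilon> \<le> a / (2 * (K + 1))"
      unfolding \<epsilon>_def by linarith+
    have "a \<le> \<epsilon> * K" using bound[OF \<epsilon>(1,2)] by (simp add: a_def)
    also have "\<dots> \<le> \<epsilon> * (2 * (K + 1)) / 2" using \<epsilon>(1) by simp
    also have "\<dots> \<le> a / 2" using \<epsilon>(3) K by (simp add: pos_le_divide_eq)
    finally show False using neg by (simp add: a_def)
  qed
qed

text \<open>The semidefinite Cauchy-Schwarz inequality; the imaginary unit recovers both components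
  of \<open>\<omega> x y\<close> from the polarisation of the energy.\<close>

lemma null_vector_in_double_annihilator:
  fixes r :: real and j :: 'k
  assumes r: "r \<noteq> 0" and j: "to_complex j = \<i>"
    and nn: "\<And>y. y \<in> annihilator \<omega> S \<Longrightarrow> r * energy \<omega> y \<ge> 0"
    and x: "x \<in> annihilator \<omega> S" "energy \<omega> x = 0"
  shows "x \<in> annihilator \<omega> (annihilator \<omega> S)"
proof -
  have re: "Re (\<i> * to_complex (\<omega> u y)) = 0"
    if y: "y \<in> annihilator \<omega> S" and u: "u \<in> annihilator \<omega> S" "energy \<omega> u = 0" for u y
  proof (rule ccontr)
    define b where "b = 2 * (r * Re (\<i> * to_complex (\<omega> u y)))"
    assume "\<not> Re (\<i> * to_complex (\<omega> u y)) = 0"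
    then have b: "b \<noteq> 0" using r by (simp add: b_def)
    have *: "r * energy \<omega> y + t * b \<ge> 0" for t
    proof -
      have tc: "to_complex (of_real t :: 'k) = of_real t"
        by (simp add: of_real_def to_complex_scaleR to_complex_one)
      have "energy \<omega> (smul (of_real t) u + y) =
          energy \<omega> y + 2 * (t * Re (\<i> * to_complex (\<omega> u y)))"
        by (simp add: energy_add energy_smul u(2) form_smul to_complex_mult tc)
      moreover have "smul (of_real t) u + y \<in> annihilator \<omega> S"
        using subspace_annihilator u(1) y by (intro subspace_add subspace_scale)
      ultimately have "0 \<le> r * (energy \<omega> y + 2 * (t * Re (\<i> * to_complex (\<omega> u y))))"
        using nn by metis
      then show ?thesis by (simp add: b_def algebra_simps)
    qed
    \<comment> \<open>An affine function of \<open>t\<close> with nonzero slope is not bounded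
      below; at this \<open>t\<close> its value is -1.\<close>
    show False using *[of "- (r * energy \<omega> y + 1) / b"] b by simp
  qed
  have "\<omega> x y = 0" if y: "y \<in> annihilator \<omega> S" for y
  proof -
    have "Re (\<i> * to_complex (\<omega> x y)) = 0" using re y x by blast
    moreover have "Re (\<i> * to_complex (\<omega> (smul j x) y)) = 0"
      using x y subspace_annihilator by (intro re) (auto simp: energy_smul subspace_scale)
    ultimately have "to_complex (\<omega> x y) = 0"
      by (simp add: form_smul to_complex_mult j complex_eq_iff)
    then show ?thesis by simp
  qed
  then show ?thesis by (auto simp: annihilator_def intro: form_eq_0_commute)
qed

text \<open>Nonzero energy puts \<open>\<omega> x x\<close> outside the reals, so the field is a
  copy of the complex numbers.\<close>

lemma ex_imaginary_unit:
  assumes "energy \<omega> x \<noteq> 0"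
  shows "\<exists>j :: 'k. to_complex j = \<i>"
proof -
  have "Im (to_complex (\<omega> x x)) \<noteq> 0" using assms by (simp add: energy_def)
  then have "range (to_complex :: 'k \<Rightarrow> complex) \<noteq> \<real>"
    by (metis complex_is_Real_iff rangeI)
  then have "range (to_complex :: 'k \<Rightarrow> complex) = UNIV" using range_to_complex by blast
  then show ?thesis by (metis UNIV_I rangeE)
qed

text \<open>Closedness. Semidefiniteness needs arbitrarily close approximants; all other parts need
  just one, at distance \<open>1/8\<close>.\<close>

lemma has_sign_limit:
  assumes h: "h \<in> {-1, 0, 1}"
    and approx: "\<And>\<epsilon>. \<epsilon> > 0 \<Longrightarrow>
      \<exists>\<omega>' S'. closed_isotropic smul \<omega>' S' \<and> near \<epsilon> \<omega> S \<omega>' S' \<and> has_sign \<omega>' S' h"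
  shows "has_sign \<omega> S h"
proof -
  have "(1/8 :: real) > 0" by simp
  then obtain \<omega>' S' where p: "closed_isotropic smul \<omega>' S'" and near: "near (1/8) \<omega> S \<omega>' S'"
    and h': "has_sign \<omega>' S' h"
    using approx by blast
  interpret p: closed_isotropic smul \<omega>' S' by fact
  show ?thesis
  proof (cases "h = 0")
    case True
    then have "S' = annihilator \<omega>' S'" using h' by (simp add: has_sign_def)
    then have "S = annihilator \<omega> S"
      using p.eq_annihilator_perturb[OF _ closed_isotropic_axioms near_sym[OF near]] by blast
    then show ?thesis using True unfolding has_sign_def by blast
  next
    case False
    have ne': "S' \<noteq> annihilator \<omega>' S'" using h' False by (simp add: has_sign_def)
    then have ne: "S \<noteq> annihilator \<omega> S" using eq_annihilator_perturb p near by blast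
    obtain z where "z \<in> annihilator \<omega>' S' - S'" using ne' p.S_le by blast
    then have "energy \<omega>' z \<noteq> 0" using h' unfolding has_sign_def by force
    then obtain j :: 'k where j: "to_complex j = \<i>" using p.ex_imaginary_unit by blast
    have nn: "of_int h * energy \<omega> x \<ge> 0" if "x \<in> annihilator \<omega> S" for x
    proof (rule energy_nonneg_limit[OF _ that])
      show "\<bar>real_of_int h\<bar> \<le> 1" using h by auto
      fix \<epsilon> :: real assume "\<epsilon> > 0"
      then obtain \<omega>2 S2 where q: "closed_isotropic smul \<omega>2 S2" "near \<epsilon> \<omega> S \<omega>2 S2" "has_sign \<omega>2 S2 h"
        using approx by blast
      interpret q: closed_isotropic smul \<omega>2 S2 by fact
      have "of_int h * energy \<omega>2 y \<ge> 0" if "y \<in> annihilator \<omega>2 S2" for y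
      proof (cases "y \<in> S2")
        case True
        then have "energy \<omega>2 y = 0" using that by (simp add: q.energy_eq_0_iff annihilator_def)
        then show ?thesis by simp
      next
        case False
        then show ?thesis using q(3) that unfolding has_sign_def by (simp add: less_imp_le)
      qed
      then show "\<exists>\<omega>' S'. closed_isotropic smul \<omega>' S' \<and> near \<epsilon> \<omega> S \<omega>' S' \<and>
          (\<forall>y\<in>annihilator \<omega>' S'. of_int h * energy \<omega>' y \<ge> 0)"
        using q by blast
    qed
    let ?D = "annihilator \<omega> (annihilator \<omega> S)"
    \<comment> \<open>The approximant is maximal isotropic, hence its own double annihilator;
      closeness of the double annihilators then yields \<open>S = ?D\<close>.\<close>
    have "annihilator \<omega>' (annihilator \<omega>' S') = S'"
      by (rule p.annihilator_annihilator_maximal[OF p.has_sign_maximal_isotropic[OF p.isotropic h']])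
    then have "semigap ?D S' < 1/8" using near_semigapD(5)[OF near] by simp
    moreover have "semigap ?D S \<le> semigap ?D S' + 2 * semigap S' S"
      by (intro semigap_triangle real_subspace_annihilator real_subspace_S p.real_subspace_S)
    ultimately have "semigap ?D S < 1" using near_semigapD(2)[OF near] by simp
    moreover have "S \<subseteq> ?D" using form_eq_0_commute by (auto simp: annihilator_def)
    ultimately have D: "S = ?D"
      by (intro subspace_eq_if_semigap_less_1 real_subspace_annihilator real_subspace_S
          closed_subspacesD(3)[OF S_closed])
    have "of_int h * energy \<omega> x > 0" if "x \<in> annihilator \<omega> S" "x \<notin> S" for x
    proof -
      have "energy \<omega> x \<noteq> 0"
        using null_vector_in_double_annihilator[OF _ j nn that(1)] that(2) D False by force
      then show ?thesis using nn[OF that(1)] False by (simp add: less_le)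
    qed
    then show ?thesis using ne False unfolding has_sign_def by blast
  qed
qed

end

section \<open>The connectedness argument\<close>

theorem theorem1p2:
  fixes smul :: "'k::real_or_complex \<Rightarrow> 'a::banach \<Rightarrow> 'a"
    and J :: "'j topology"
    and \<omega> :: "'j \<Rightarrow> 'a \<Rightarrow> 'a \<Rightarrow> 'k"
    and \<Lambda> :: "'j \<Rightarrow> 'a set"
    and s0 :: 'j
  assumes "banach_space_over smul"
    and "connected_space J"
    and "\<And>s. s \<in> topspace J \<Longrightarrow> symplectic smul (\<omega> s)"
    and "continuous_map J euclidean (\<lambda>s. form_map (\<omega> s))"
    and "continuous_map J (gap_topology smul) \<Lambda>"
    and "\<And>s. s \<in> topspace J \<Longrightarrow> \<Lambda> s \<subseteq> annihilator (\<omega> s) (\<Lambda> s)"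
    and "continuous_map J (gap_topology smul) (\<lambda>s. annihilator (\<omega> s) (\<Lambda> s))"
    and "continuous_map J (gap_topology smul)
           (\<lambda>s. annihilator (\<omega> s) (annihilator (\<omega> s) (\<Lambda> s)))"
    and "s0 \<in> topspace J"
    and "maximal_isotropic smul (\<omega> s0) (\<Lambda> s0)"
    and "form_sign (\<omega> s0) (\<Lambda> s0) \<noteq> 0 \<Longrightarrow> reduced_min_modulus (\<omega> s0) (\<Lambda> s0) > 0"
    and "\<And>s. s \<in> topspace J \<Longrightarrow> maximal_isotropic smul (\<omega> s) (\<Lambda> s) \<Longrightarrow>
           form_sign (\<omega> s) (\<Lambda> s) \<noteq> 0 \<Longrightarrow> reduced_min_modulus (\<omega> s) (\<Lambda> s) > 0"
  shows "\<forall>s\<in>topspace J. maximal_isotropic smul (\<omega> s) (\<Lambda> s) \<and>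
           form_sign (\<omega> s) (\<Lambda> s) = form_sign (\<omega> s0) (\<Lambda> s0)"
proof -
  interpret banach_space_over smul by fact
  have ci: "closed_isotropic smul (\<omega> s) (\<Lambda> s)" if "s \<in> topspace J" for s
  proof -
    have "\<Lambda> s \<in> closed_subspaces smul"
      using continuous_map_image_subset_topspace[OF assms(5)] that by auto
    then show ?thesis
      using assms(3)[OF that] assms(6)[OF that] unfolding symplectic_def
      by (intro closed_isotropic.intro skew_form.intro skew_form_axioms.intro
          closed_isotropic_axioms.intro banach_space_over_axioms) auto
  qed
  have nbhd: "\<exists>U. openin J U \<and> s \<in> U \<and> (\<forall>t\<in>U. near \<epsilon> (\<omega> s) (\<Lambda> s) (\<omega> t) (\<Lambda> t))"
    if s: "s \<in> topspace J" and \<epsilon>: "\<epsilon> > 0" for s \<epsilon>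
  proof -
    obtain U1 where U1: "openin J U1" "s \<in> U1" "\<And>t. t \<in> U1 \<Longrightarrow> gap (\<Lambda> s) (\<Lambda> t) < \<epsilon>"
      using continuous_map_gapD[OF assms(5) s \<epsilon>] by blast
    obtain U2 where U2: "openin J U2" "s \<in> U2"
      "\<And>t. t \<in> U2 \<Longrightarrow> gap (annihilator (\<omega> s) (\<Lambda> s)) (annihilator (\<omega> t) (\<Lambda> t)) < \<epsilon>"
      using continuous_map_gapD[OF assms(7) s \<epsilon>] by blast
    obtain U3 where U3: "openin J U3" "s \<in> U3"
      "\<And>t. t \<in> U3 \<Longrightarrow> gap (annihilator (\<omega> s) (annihilator (\<omega> s) (\<Lambda> s)))
         (annihilator (\<omega> t) (annihilator (\<omega> t) (\<Lambda> t))) < \<epsilon>"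
      using continuous_map_gapD[OF assms(8) s \<epsilon>] by blast
    define U4 where "U4 = {t \<in> topspace J. form_map (\<omega> t) \<in> ball (form_map (\<omega> s)) \<epsilon>}"
    have "openin J U4"
      unfolding U4_def using assms(4) by (rule openin_continuous_map_preimage) simp
    moreover have "s \<in> U4" "\<And>t. t \<in> U4 \<Longrightarrow> norm (form_map (\<omega> s) - form_map (\<omega> t)) < \<epsilon>"
      using s \<epsilon> by (auto simp: U4_def dist_norm)
    ultimately show ?thesis using U1 U2 U3
      by (intro exI[of _ "U1 \<inter> U2 \<inter> U3 \<inter> U4"]) (auto simp: near_def)
  qed
  interpret s0: closed_isotropic smul "\<omega> s0" "\<Lambda> s0" using ci assms(9) by blast
  obtain h where h: "h \<in> {-1, 0, 1}" "has_sign (\<omega> s0) (\<Lambda> s0) h"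
    using s0.maximal_isotropic_has_sign[OF assms(10)] by blast
  define A where "A = {s \<in> topspace J. has_sign (\<omega> s) (\<Lambda> s) h}"
  have sign: "maximal_isotropic smul (\<omega> s) (\<Lambda> s)" "form_sign (\<omega> s) (\<Lambda> s) = h"
    if "s \<in> A" for s
  proof -
    interpret s: closed_isotropic smul "\<omega> s" "\<Lambda> s" using ci that by (simp add: A_def)
    show "maximal_isotropic smul (\<omega> s) (\<Lambda> s)" "form_sign (\<omega> s) (\<Lambda> s) = h"
      using that s.has_sign_maximal_isotropic[OF s.isotropic] s.has_sign_form_sign[OF s.isotropic h(1)]
      by (auto simp: A_def)
  qed
  have "openin J A"
  proof (subst openin_subopen, intro ballI)
    fix s assume s: "s \<in> A"
    then have sJ: "s \<in> topspace J" "has_sign (\<omega> s) (\<Lambda> s) h" by (auto simp: A_def)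
    interpret s: closed_isotropic smul "\<omega> s" "\<Lambda> s" using ci sJ by blast
    \<comment> \<open>The modulus assumption is available at \<open>s\<close> because membership in
      \<open>A\<close> already gives maximality and identifies \<open>form_sign\<close> with
      \<open>h\<close>.\<close>
    have "h \<noteq> 0 \<Longrightarrow> reduced_min_modulus (\<omega> s) (\<Lambda> s) > 0"
      using assms(12)[OF sJ(1)] sign[OF s] by simp
    then obtain \<epsilon> where \<epsilon>: "\<epsilon> > 0"
      "\<And>\<omega>' S'. closed_isotropic smul \<omega>' S' \<Longrightarrow> near \<epsilon> (\<omega> s) (\<Lambda> s) \<omega>' S' \<Longrightarrow> has_sign \<omega>' S' h"
      using s.has_sign_perturb[OF h(1) sJ(2)] by blast
    obtain U where U: "openin J U" "s \<in> U" "\<And>t. t \<in> U \<Longrightarrow> near \<epsilon> (\<omega> s) (\<Lambda> s) (\<omega> t) (\<Lambda> t)"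
      using nbhd[OF sJ(1) \<epsilon>(1)] by blast
    have "U \<subseteq> A"
      using U \<epsilon>(2) ci openin_subset[OF U(1)] by (auto simp: A_def)
    then show "\<exists>U. openin J U \<and> s \<in> U \<and> U \<subseteq> A" using U by blast
  qed
  moreover have "openin J (topspace J - A)"
  proof (subst openin_subopen, intro ballI)
    fix s assume s: "s \<in> topspace J - A"
    then interpret s: closed_isotropic smul "\<omega> s" "\<Lambda> s" using ci by blast
    have "\<not> has_sign (\<omega> s) (\<Lambda> s) h" using s by (simp add: A_def)
    \<comment> \<open>Contrapositive of the limit lemma: if the sign fails at \<open>s\<close>, it
      fails at everything within some radius.\<close>
    then obtain \<epsilon> where \<epsilon>: "\<epsilon> > 0"
      "\<And>\<omega>' S'. closed_isotropic smul \<omega>' S' \<Longrightarrow> near \<epsilon> (\<omega> s) (\<Lambda> s) \<omega>' S' \<Longrightarrow> \<not> has_sign \<omega>' S' h"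
      using s.has_sign_limit[OF h(1)] by blast
    obtain U where U: "openin J U" "s \<in> U" "\<And>t. t \<in> U \<Longrightarrow> near \<epsilon> (\<omega> s) (\<Lambda> s) (\<omega> t) (\<Lambda> t)"
      using nbhd[of s, OF _ \<epsilon>(1)] s by blast
    have "U \<subseteq> topspace J - A"
      using U \<epsilon>(2) ci openin_subset[OF U(1)] by (auto simp: A_def)
    then show "\<exists>U. openin J U \<and> s \<in> U \<and> U \<subseteq> topspace J - A" using U by blast
  qed
  then have "closedin J A" by (auto simp: closedin_def A_def)
  ultimately have "A = {} \<or> A = topspace J"
    using assms(2) connected_space_clopen_in by blast
  moreover have s0A: "s0 \<in> A" using assms(9) h(2) by (simp add: A_def)
  ultimately show ?thesis using sign sign(2)[OF s0A] by blast
qed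

end
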